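(* Let $q$ be a prime power and let $0<\rho<n\le m$ be integers. Define $$\epsilon = \left\lceil \frac{(q^m-q^\rho)\left({n\brack 1}-{\rho\brack 1}\right)}{q^\rho{\rho+1\brack 1}}\right\rceil q^\rho{\rho+1\brack 1} + (q^m-q^\rho)\left({\rho\brack 1}-{n\brack 1}\right)$$ and $\delta = v(1)-q^{\rho-1}{\rho\brack 1}-1+2\epsilon$. If $\epsilon>0$, then $$K_R(q^m,n,\rho)\ge \frac{q^{mn}}{v(\rho)-\frac{\epsilon}{\delta}N_\rho(q^m,n)}.$$
   Context: For $\mathbf{x}\in \mathrm{GF}(q^m)^n$, $\mathrm{rk}(\mathbf{x})$ is the maximum number of coordinates of $\mathbf{x}$ that are linearly independent over $\mathrm{GF}(q)$; the rank distance is $d_R(\mathbf{x},\mathbf{y})=\mathrm{rk}(\mathbf{x}-\mathbf{y})$. $N_u(q^m,n)$ is the number of vectors of rank exactly $u$ in $\mathrm{GF}(q^m)^n$, and $v(r)=\sum_{u=0}^r N_u(q^m,n)$ is the number of vectors in a ball of rank radius $r$. ${k\brack 1}=\frac{q^k-1}{q-1}$. The rank covering radius of a nonempty code $C\subseteq \mathrm{GF}(q^m)^n$ is $\max_{\mathbf{x}}\min_{\mathbf{c}\in C} d_R(\mathbf{x},\mathbf{c})$. $K_R(q^m,n,\rho)$ denotes the minimum number of balls of rank radius $\rho$ needed to cover $\mathrm{GF}(q^m)^n$, i.e. the minimum cardinality of a (not necessarily linear) code $C\subseteq\mathrm{GF}(q^m)^n$ with rank covering radius at most $\rho$. *)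

theory Defs
  imports "HOL-Analysis.Finite_Cartesian_Product" "HOL-Number_Theory.Prime_Powers"
begin

(* GF(q) and GF(q^m) are types 'k and 'l of sort {field, finite} together with an embedding
   'k \<Rightarrow> 'l; GF(q^m)^n is the type 'l ^ 'n with CARD('n) = n. *)

definition field_embedding :: "('k::field \<Rightarrow> 'l::field) \<Rightarrow> bool" where
  "field_embedding emb \<longleftrightarrow>
     emb 1 = 1 \<and> (\<forall>a b. emb (a + b) = emb a + emb b) \<and> (\<forall>a b. emb (a * b) = emb a * emb b)"

definition ext_scale :: "('k::field \<Rightarrow> 'l::field) \<Rightarrow> 'k \<Rightarrow> 'l \<Rightarrow> 'l" where
  "ext_scale emb a y = emb a * y"

lemma vector_space_ext_scale:
  "field_embedding emb \<Longrightarrow> vector_space (ext_scale emb)"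
  by unfold_locales (auto simp: field_embedding_def ext_scale_def algebra_simps)

(* Independence in the library is a property of sets; injectivity on I makes it independence of
   the family of the coordinates with index in I. *)
definition rk :: "('k::field \<Rightarrow> 'l::field) \<Rightarrow> 'l ^ 'n \<Rightarrow> nat" where
  "rk emb x = Max {card I | I.
     inj_on (\<lambda>i. x $ i) I \<and> \<not> module.dependent (ext_scale emb) ((\<lambda>i. x $ i) ` I)}"

definition rank_dist :: "('k::field \<Rightarrow> 'l::field) \<Rightarrow> 'l ^ 'n \<Rightarrow> 'l ^ 'n \<Rightarrow> nat" where
  "rank_dist emb x y = rk emb (x - y)"

definition rank_count :: "('k::field \<Rightarrow> 'l::field) \<Rightarrow> 'n::finite itself \<Rightarrow> nat \<Rightarrow> nat" where
  "rank_count emb _ u = card {x :: 'l ^ 'n::finite. rk emb x = u}"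

definition ball_volume :: "('k::field \<Rightarrow> 'l::field) \<Rightarrow> 'n::finite itself \<Rightarrow> nat \<Rightarrow> nat" where
  "ball_volume emb N r = (\<Sum>u = 0..r. rank_count emb N u)"

definition covering_radius ::
    "('k::field \<Rightarrow> 'l::{field,finite}) \<Rightarrow> ('l ^ 'n::finite) set \<Rightarrow> nat" where
  "covering_radius emb C = Max (range (\<lambda>x. Min (rank_dist emb x ` C)))"

definition K_R :: "('k::field \<Rightarrow> 'l::{field,finite}) \<Rightarrow> 'n::finite itself \<Rightarrow> nat \<Rightarrow> nat" where
  "K_R emb _ \<rho> = Min {card C | C :: ('l ^ 'n::finite) set. C \<noteq> {} \<and> covering_radius emb C \<le> \<rho>}"

definition q_bracket :: "nat \<Rightarrow> nat \<Rightarrow> real" where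
  "q_bracket q k = (real q ^ k - 1) / (real q - 1)"

end

(* The coordinates of x over GF(q^m) define the GF(q)-linear map v |-> sum_i v_i x_i from GF(q)^n
   to GF(q^m), whose image has q^(rk x) elements. Adding the rank one vector a f changes the rank by
   at most 1: it goes up iff a lies outside the image and f does not vanish on the kernel, and it
   goes down iff f vanishes on the kernel and maps the preimages of a to -1. Counting such pairs
   (a, f) gives the intersection numbers of a unit ball with a ball of radius rho.

   For a covering code C with K words, let the excess of x be the number of codewords within
   distance rho of x, minus 1; the total excess is K v(rho) - q^(mn). Call x tight if it has excess
   0 and its codeword is at distance exactly rho. The excess of the unit ball around a tight x
   is c B - b >= 0, where c and b are intersection numbers and B counts the codewords at distance
   rho + 1; as B is an integer, this excess is at least epsilon. Conversely, the unit ball around a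
   point of positive excess contains at most delta - 2 epsilon tight points. Since the pairs of a
   point and a codeword at distance rho number at most |tight| + 2 (total excess), double counting
   bounds the total excess from below by (epsilon / delta) K N_rho. *)

theory Submission
  imports Defs "HOL-Analysis.Cartesian_Space"
begin

section \<open>Counting by fibres\<close>

lemma card_eq_mult_card_fibres:
  assumes "finite A" and "\<And>y. y \<in> f ` A \<Longrightarrow> card {x \<in> A. f x = y} = k"
  shows "card A = k * card (f ` A)"
proof -
  have "(\<Sum>x\<in>A. card {y \<in> f ` A. f x = y}) = k * card (f ` A)"
    by (rule sum_multicount) (use assms in auto)
  moreover have "card {y \<in> f ` A. f x = y} = 1" if "x \<in> A" for x
  proof -
    have "{y \<in> f ` A. f x = y} = {f x}" using that by auto
    then show ?thesis by simp
  qed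
  ultimately show ?thesis by simp
qed

text \<open>Every fibre over the image is a translate of the kernel. Only additivity is asked of
  \<open>f\<close>, so the lemma serves both \<open>dot u\<close> and the coordinate map, whose
  values lie in a different field.\<close>

lemma card_eq_card_kernel_mult_card_image:
  fixes f :: "'a::ab_group_add \<Rightarrow> 'b::ab_group_add"
  assumes "finite W"
    and add: "\<And>x y. x \<in> W \<Longrightarrow> y \<in> W \<Longrightarrow> x + y \<in> W"
    and diff: "\<And>x y. x \<in> W \<Longrightarrow> y \<in> W \<Longrightarrow> x - y \<in> W"
    and hom: "\<And>x y. f (x + y) = f x + f y"
  shows "card W = card {x \<in> W. f x = 0} * card (f ` W)"
proof (rule card_eq_mult_card_fibres[OF \<open>finite W\<close>])
  have f_diff: "f (x - y) = f x - f y" for x y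
    using hom[of "x - y" y] by simp
  fix y assume "y \<in> f ` W"
  then obtain z where z: "z \<in> W" "f z = y" by auto
  have "bij_betw (\<lambda>x. x - z) {x \<in> W. f x = y} {x \<in> W. f x = 0}"
    by (rule bij_betw_byWitness[where f' = "\<lambda>x. x + z"])
      (use z in \<open>auto simp: hom f_diff intro: add diff\<close>)
  then show "card {x \<in> W. f x = y} = card {x \<in> W. f x = 0}"
    by (rule bij_betw_same_card)
qed

section \<open>Annihilators over a finite field\<close>

definition dot :: "'k::field ^ 'n \<Rightarrow> 'k ^ 'n \<Rightarrow> 'k" where
  "dot u v = (\<Sum>i\<in>UNIV. u $ i * v $ i)"

lemma dot_commute: "dot u v = dot v u"
  by (simp add: dot_def mult.commute)

lemma dot_simps [simp]:
  "dot u (v + w) = dot u v + dot u w" "dot (u + v) w = dot u w + dot v w"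
  "dot u (v - w) = dot u v - dot u w" "dot (u - v) w = dot u w - dot v w"
  "dot u (c *s v) = c * dot u v" "dot (c *s u) v = c * dot u v"
  "dot u (- v) = - dot u v" "dot (- u) v = - dot u v"
  "dot u 0 = 0" "dot 0 v = 0"
  by (simp_all add: dot_def algebra_simps sum.distrib sum_subtractf sum_distrib_left sum_negf)

lemma dot_nondegenerate:
  assumes "u \<noteq> 0"
  obtains v where "dot u v = 1"
proof -
  obtain i where "u $ i \<noteq> 0"
    using assms by (auto simp: vec_eq_iff)
  have "dot u (axis i (inverse (u $ i))) = (\<Sum>j\<in>UNIV. if j = i then u $ i * inverse (u $ i) else 0)"
    unfolding dot_def by (rule sum.cong) (auto simp: axis_def)
  also have "\<dots> = 1" using \<open>u $ i \<noteq> 0\<close> by simp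
  finally show thesis by (rule that)
qed

text \<open>A vector of \<open>W\<close> outside the kernel makes \<open>dot u\<close> map
  \<open>W\<close> onto the field, and all level sets are translates of the kernel. The level
  \<open>c\<close> is kept general because the count of rank-lowering vectors needs level
  -1.\<close>

lemma card_hyperplane:
  fixes u :: "'k::{field,finite} ^ 'n"
  assumes W: "vec.subspace W" and w: "w \<in> W" "dot u w \<noteq> 0"
  shows "card W = CARD('k) * card {v \<in> W. dot u v = c}"
proof -
  let ?t = "\<lambda>c. (c / dot u w) *s w"
  have t: "?t c \<in> W" "dot u (?t c) = c" for c
    using W w by (simp_all add: vec.subspace_scale)
  have "c \<in> dot u ` W" for c
    using t[of c] by (intro image_eqI) auto
  then have "dot u ` W = UNIV" by auto
  moreover have "card W = card {v \<in> W. dot u v = 0} * card (dot u ` W)"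
    by (rule card_eq_card_kernel_mult_card_image)
      (use W in \<open>auto simp: vec.subspace_add vec.subspace_diff\<close>)
  moreover have "bij_betw (\<lambda>v. v + ?t c) {v \<in> W. dot u v = 0} {v \<in> W. dot u v = c}"
    by (rule bij_betw_byWitness[where f' = "\<lambda>v. v - ?t c"])
      (use W t in \<open>auto simp: vec.subspace_add vec.subspace_diff simp del: dot_simps(5)\<close>)
  ultimately show ?thesis by (simp add: bij_betw_same_card)
qed

text \<open>Over a finite field a nonzero vector may be orthogonal to itself, so this set can meet
  \<open>W\<close> nontrivially and need not be a complement of it. Its size is therefore found by
  counting.\<close>

definition annihilator :: "('k::field ^ 'n) set \<Rightarrow> ('k ^ 'n) set" where
  "annihilator W = {u. \<forall>v\<in>W. dot u v = 0}"

lemma subspace_annihilator: "vec.subspace (annihilator W)"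
  by (auto simp: annihilator_def vec.subspace_def)

(* Double counting of the orthogonal pairs (u, v) with v in W. *)
lemma card_annihilator:
  fixes W :: "('k::{field,finite} ^ 'n) set"
  assumes W: "vec.subspace W"
  shows "card W * card (annihilator W) = CARD('k) ^ CARD('n)"
proof -
  let ?q = "int CARD('k)" and ?Q = "int (CARD('k) ^ CARD('n))"
  let ?N = "int (card W)" and ?a = "int (card (annihilator W))"
  have q: "?q > 1"
    using card_mono[of UNIV "{0, 1 :: 'k}"] by simp
  have Q: "?Q = int CARD('k ^ 'n)" by simp
  have "0 \<in> W" using W by (rule vec.subspace_0)
  have Npos: "?N \<ge> 1" using \<open>0 \<in> W\<close> card_gt_0_iff[of W] by force
  have "(\<Sum>u\<in>UNIV. card {v \<in> W. dot u v = 0}) = (\<Sum>v\<in>W. card {u \<in> UNIV. dot u v = 0})"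
    by (rule sum_multicount_gen) auto
  then have "(\<Sum>u\<in>UNIV. ?q * int (card {v \<in> W. dot u v = 0}))
      = (\<Sum>v\<in>W. ?q * int (card {u. dot u v = 0}))"
    unfolding sum_distrib_left[symmetric] of_nat_sum[symmetric] by simp
  also have "(\<Sum>u\<in>UNIV. ?q * int (card {v \<in> W. dot u v = 0}))
      = (\<Sum>u\<in>UNIV. ?N + (if u \<in> annihilator W then (?q - 1) * ?N else 0))"
  proof (rule sum.cong[OF refl])
    fix u :: "'k ^ 'n"
    show "?q * int (card {v \<in> W. dot u v = 0})
        = ?N + (if u \<in> annihilator W then (?q - 1) * ?N else 0)"
    proof (cases "u \<in> annihilator W")
      case True
      then have "{v \<in> W. dot u v = 0} = W" by (auto simp: annihilator_def)
      with True show ?thesis by (simp add: algebra_simps)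
    next
      case False
      then obtain v where "v \<in> W" "dot u v \<noteq> 0" by (auto simp: annihilator_def)
      from card_hyperplane[OF W this, of 0] False show ?thesis by simp
    qed
  qed
  also have "\<dots> = ?Q * ?N + ?a * ((?q - 1) * ?N)"
    by (simp add: sum.distrib sum.If_cases)
  also have "(\<Sum>v\<in>W. ?q * int (card {u. dot u v = 0}))
      = (\<Sum>v\<in>W. ?Q + (if v = 0 then (?q - 1) * ?Q else 0))"
  proof (rule sum.cong[OF refl])
    fix v :: "'k ^ 'n"
    show "?q * int (card {u. dot u v = 0}) = ?Q + (if v = 0 then (?q - 1) * ?Q else 0)"
    proof (cases "v = 0")
      case True
      then show ?thesis by (simp add: algebra_simps)
    next
      case False
      then obtain u where "dot v u = 1" by (rule dot_nondegenerate)
      then have "CARD('k ^ 'n) = CARD('k) * card {u \<in> UNIV. dot v u = 0}"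
        by (intro card_hyperplane[of _ u]) auto
      then have "?Q = ?q * int (card {u. dot v u = 0})"
        unfolding Q by simp
      with False show ?thesis by (simp add: dot_commute)
    qed
  qed
  also have "\<dots> = ?N * ?Q + (?q - 1) * ?Q"
    using \<open>0 \<in> W\<close> by (simp add: sum.distrib)
  \<comment> \<open>The term \<open>?N * ?Q\<close> occurs on both sides and cancels.\<close>
  finally have "(?q - 1) * (?N * ?a) = (?q - 1) * ?Q" by (simp add: algebra_simps)
  then have "?N * ?a = ?Q" using q by simp
  then show ?thesis unfolding of_nat_mult[symmetric] of_nat_eq_iff .
qed

text \<open>Without such an \<open>f\<close>, adjoining \<open>v\<close> would enlarge
  \<open>W\<close> and leave its annihilator at least as large, which contradicts the constant
  product in \<open>card_annihilator\<close>.\<close>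

lemma annihilator_separates:
  fixes W :: "('k::{field,finite} ^ 'n) set"
  assumes W: "vec.subspace W" and v: "v \<notin> W"
  obtains f where "f \<in> annihilator W" "dot f v \<noteq> 0"
proof (rule ccontr)
  assume neg: "\<not> thesis"
  let ?W' = "vec.span (insert v W)"
  have "annihilator W \<subseteq> annihilator ?W'"
  proof
    fix f assume f: "f \<in> annihilator W"
    with neg that have fv: "dot f v = 0" by blast
    have "dot f w = 0" if "w \<in> ?W'" for w
    proof -
      from that obtain c where "w - c *s v \<in> vec.span W" by (auto simp: vec.span_breakdown_eq)
      then have "w - c *s v \<in> W" using W by (metis vec.span_eq_iff)
      with f have "dot f (w - c *s v) = 0" by (auto simp: annihilator_def simp del: dot_simps)
      then show ?thesis using fv by simp
    qed
    then show "f \<in> annihilator ?W'" by (simp add: annihilator_def)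
  qed
  then have le: "card (annihilator W) \<le> card (annihilator ?W')" by (intro card_mono) auto
  have "W \<subset> ?W'" using v by (auto intro: vec.span_base)
  then have "card W < card ?W'" by (intro psubset_card_mono) auto
  moreover have "card (annihilator W) > 0"
    using subspace_annihilator[of W, THEN vec.subspace_0] by (auto simp: card_gt_0_iff)
  ultimately have "card W * card (annihilator W) < card ?W' * card (annihilator ?W')"
    using le by (intro mult_less_le_imp_less) auto
  then show False
    by (simp add: card_annihilator[OF W] card_annihilator[OF vec.subspace_span])
qed

section \<open>The rank of a vector\<close>

locale finite_field_embedding =
  fixes emb :: "'k::{field,finite} \<Rightarrow> 'l::{field,finite}"
  assumes field_embedding: "field_embedding emb"
begin

lemma emb_simps [simp]:
  "emb 0 = 0" "emb 1 = 1" "emb (a + b) = emb a + emb b" "emb (a * b) = emb a * emb b"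
  "emb (- a) = - emb a" "emb (a - b) = emb a - emb b"
proof -
  show 1: "emb 1 = 1" and 2: "emb (a + b) = emb a + emb b" and 3: "emb (a * b) = emb a * emb b" for a b
    using field_embedding by (auto simp: field_embedding_def)
  show 4: "emb 0 = 0" using 2[of 0 0] by (simp only: add_0_left add_cancel_right_right)
  show 5: "emb (- a) = - emb a" for a using 2[of a "- a"] 4 by (simp add: add_eq_0_iff)
  show "emb (a - b) = emb a - emb b" using 2[of a "- b"] 5 by simp
qed

lemma emb_eq_0_iff [simp]: "emb a = 0 \<longleftrightarrow> a = 0"
proof
  assume "emb a = 0"
  then have "a \<noteq> 0 \<Longrightarrow> emb (a * inverse a) = 0" by (simp only: emb_simps mult_zero_left)
  then show "a = 0" by auto
qed simp

lemma emb_inverse [simp]: "emb (inverse a) = inverse (emb a)"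
proof (cases "a = 0")
  case False
  then have "emb a * emb (inverse a) = 1" by (metis emb_simps(2,4) right_inverse)
  then show ?thesis by (metis inverse_unique)
qed simp

lemma emb_divide [simp]: "emb (a / b) = emb a / emb b"
  by (simp only: divide_inverse emb_simps emb_inverse)

lemma emb_eq_iff [simp]: "emb a = emb b \<longleftrightarrow> a = b"
  using emb_eq_0_iff[of "a - b"] by simp

lemma emb_sum: "emb (sum f A) = (\<Sum>i\<in>A. emb (f i))"
  by (induction A rule: infinite_finite_induct) simp_all

sublocale ext: vector_space "ext_scale emb"
  by (rule vector_space_ext_scale) (rule field_embedding)

lemma q_gt_1: "CARD('k) > 1"
  using card_mono[of UNIV "{0, 1 :: 'k}"] by simp

text \<open>Adjoining an independent \<open>b\<close> makes each element of the new span uniquely a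
  multiple of \<open>b\<close> plus an element of the old one, so the size is multiplied by
  q.\<close>

lemma card_span:
  assumes "ext.independent B"
  shows "card (ext.span B) = CARD('k) ^ card B"
proof -
  have "finite B" by simp
  then show ?thesis using assms
  proof (induction B rule: finite_induct)
    case (insert b B)
    have indep: "ext.independent B" and b: "b \<notin> ext.span B"
      using insert.hyps insert.prems by (auto simp: ext.independent_insert)
    let ?f = "\<lambda>(c, s). ext_scale emb c b + s"
    have "bij_betw ?f (UNIV \<times> ext.span B) (ext.span (insert b B))"
    proof (rule bij_betw_imageI)
      show "inj_on ?f (UNIV \<times> ext.span B)"
      proof (rule inj_onI, clarify)
        fix c s c' s'
        assume s: "s \<in> ext.span B" "s' \<in> ext.span B"
          and eq: "ext_scale emb c b + s = ext_scale emb c' b + s'"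
        then have "ext_scale emb (c - c') b = s' - s"
          by (simp add: ext.scale_left_diff_distrib algebra_simps)
        then have "ext_scale emb (c - c') b \<in> ext.span B"
          using s by (simp add: ext.span_diff)
        \<comment> \<open>Otherwise dividing by \<open>c - c'\<close> would put \<open>b\<close>
          into the span of \<open>B\<close>.\<close>
        then have "c = c'"
          using b ext.span_scale[of "ext_scale emb (c - c') b" B "inverse (c - c')"]
          by (cases "c = c'") auto
        with eq show "c = c' \<and> s = s'" by simp
      qed
      show "?f ` (UNIV \<times> ext.span B) = ext.span (insert b B)"
      proof (intro set_eqI iffI)
        fix y assume "y \<in> ?f ` (UNIV \<times> ext.span B)"
        then obtain c s where "s \<in> ext.span B" "y = ext_scale emb c b + s" by auto
        then show "y \<in> ext.span (insert b B)"
          by (auto simp: ext.span_breakdown_eq intro!: exI[of _ c])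
      next
        fix y assume "y \<in> ext.span (insert b B)"
        then obtain c where "y - ext_scale emb c b \<in> ext.span B"
          by (auto simp: ext.span_breakdown_eq)
        then show "y \<in> ?f ` (UNIV \<times> ext.span B)"
          by (intro image_eqI[of _ _ "(c, y - ext_scale emb c b)"]) auto
      qed
    qed
    then have "card (ext.span (insert b B)) = card (UNIV \<times> ext.span B :: ('k \<times> 'l) set)"
      by (metis bij_betw_same_card)
    with insert.IH[OF indep] insert.hyps show ?case by (simp add: card_cartesian_product)
  qed simp
qed

section \<open>The coordinate map, its image and its kernel\<close>

definition coord_map :: "'l ^ 'n \<Rightarrow> 'k ^ 'n \<Rightarrow> 'l" where
  "coord_map x v = (\<Sum>i\<in>UNIV. emb (v $ i) * x $ i)"

lemma coord_map_simps [simp]: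
  "coord_map x (v + w) = coord_map x v + coord_map x w"
  "coord_map x (v - w) = coord_map x v - coord_map x w"
  "coord_map x (- v) = - coord_map x v"
  "coord_map x (c *s v) = emb c * coord_map x v"
  "coord_map (x + y) v = coord_map x v + coord_map y v"
  "coord_map (- x) v = - coord_map x v"
  "coord_map x 0 = 0" "coord_map 0 v = 0"
  by (simp_all add: coord_map_def algebra_simps sum.distrib sum_subtractf sum_distrib_left sum_negf)

lemma coord_map_axis [simp]: "coord_map x (axis i c) = emb c * x $ i"
proof -
  have "coord_map x (axis i c) = (\<Sum>j\<in>UNIV. if j = i then emb c * x $ i else 0)"
    unfolding coord_map_def by (rule sum.cong) (auto simp: axis_def)
  then show ?thesis by simp
qed

definition relations :: "'l ^ 'n \<Rightarrow> ('k ^ 'n) set" where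
  "relations x = {v. coord_map x v = 0}"

lemma relations_iff [simp]: "v \<in> relations x \<longleftrightarrow> coord_map x v = 0"
  by (simp add: relations_def)

lemma subspace_relations: "vec.subspace (relations x)"
  by (auto simp: vec.subspace_def)

lemma range_coord_map: "range (coord_map x) = ext.span (range (($) x))"
proof
  show "range (coord_map x) \<subseteq> ext.span (range (($) x))"
  proof (rule image_subsetI)
    fix v
    have "(\<Sum>i\<in>UNIV. ext_scale emb (v $ i) (x $ i)) \<in> ext.span (range (($) x))"
      by (intro ext.span_sum ext.span_scale ext.span_base) simp
    then show "coord_map x v \<in> ext.span (range (($) x))"
      by (simp add: coord_map_def ext_scale_def)
  qed
  show "ext.span (range (($) x)) \<subseteq> range (coord_map x)"
  proof (rule ext.span_minimal)
    show "range (($) x) \<subseteq> range (coord_map x)"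
    proof (rule image_subsetI)
      fix i
      have "x $ i = coord_map x (axis i 1)" by simp
      then show "x $ i \<in> range (coord_map x)" by (rule range_eqI)
    qed
    show "ext.subspace (range (coord_map x))"
      unfolding ext.subspace_def
    proof (intro conjI ballI allI)
      show "0 \<in> range (coord_map x)" by (rule range_eqI[of _ _ 0]) simp
    next
      fix a b assume "a \<in> range (coord_map x)" "b \<in> range (coord_map x)"
      then obtain v w where "a = coord_map x v" "b = coord_map x w" by auto
      then show "a + b \<in> range (coord_map x)" by (intro range_eqI[of _ _ "v + w"]) simp
    next
      fix c a assume "a \<in> range (coord_map x)"
      then obtain v where "a = coord_map x v" by auto
      then show "ext_scale emb c a \<in> range (coord_map x)"
        by (intro range_eqI[of _ _ "c *s v"]) (simp add: ext_scale_def)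
    qed
  qed
qed

text \<open>A maximal independent set \<open>B\<close> of coordinates spans the image, and its size
  is the maximum that defines the rank.\<close>

lemma card_range_coord_map:
  fixes x :: "'l ^ 'n"
  shows "card (range (coord_map x)) = CARD('k) ^ rk emb x"
proof -
  obtain B where B: "B \<subseteq> range (($) x)" "ext.independent B" "range (($) x) \<subseteq> ext.span B"
    by (rule ext.maximal_independent_subset)
  let ?S = "{card I | I. inj_on (\<lambda>i. x $ i) I \<and> ext.independent ((\<lambda>i. x $ i) ` I)}"
  have "rk emb x = card B"
    unfolding rk_def
  proof (rule Max_eqI)
    have "?S \<subseteq> card ` (UNIV :: 'n set set)" by auto
    then show "finite ?S" by (rule finite_subset) simp
  next
    fix k assume "k \<in> ?S"
    then obtain I where I: "k = card I" "inj_on (\<lambda>i. x $ i) I" "ext.independent ((\<lambda>i. x $ i) ` I)"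
      by auto
    have "card ((\<lambda>i. x $ i) ` I) \<le> card B"
      using ext.independent_span_bound[OF _ I(3), of B] B(3) by auto
    then show "k \<le> card B" using I by (simp add: card_image)
  next
    \<comment> \<open>One index is chosen for each element of \<open>B\<close>, which turns the
      independent set into an independent family.\<close>
    obtain I where "inj_on (($) x) I" "B = ($) x ` I"
      using B(1) by (auto simp: subset_image_inj)
    then show "card B \<in> ?S"
      using B(2) by (auto simp: card_image intro!: exI[of _ I])
  qed
  moreover have "ext.span (range (($) x)) = ext.span B"
    using B(1,3) by (intro subset_antisym ext.span_minimal ext.span_mono ext.subspace_span)
  ultimately show ?thesis
    using card_span[OF B(2)] by (simp add: range_coord_map)
qed

text \<open>Rank-nullity for \<open>coord_map x\<close>, in multiplicative form.\<close>

lemma card_relations: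
  fixes x :: "'l ^ 'n"
  shows "card (relations x) * CARD('k) ^ rk emb x = CARD('k) ^ CARD('n)"
proof -
  have "CARD('k ^ 'n) = card {v \<in> UNIV. coord_map x v = 0} * card (range (coord_map x))"
    by (rule card_eq_card_kernel_mult_card_image) auto
  then show ?thesis by (simp add: card_range_coord_map relations_def)
qed

lemma relations_nonempty [simp]: "relations x \<noteq> {}"
  by (metis coord_map_simps(7) empty_iff relations_iff)

text \<open>Ranks are compared through the sizes of the kernels. The exponents \<open>i\<close> and
  \<open>j\<close> let the kernels differ by powers of q in either direction without subtraction of
  naturals.\<close>

lemma rk_eq_if_card_relations:
  fixes x y :: "'l ^ 'n"
  assumes "card (relations x) * CARD('k) ^ i = card (relations y) * CARD('k) ^ j"
  shows "rk emb x + j = rk emb y + i"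
proof -
  have "card (relations x) * CARD('k) ^ rk emb x = card (relations y) * CARD('k) ^ rk emb y"
    by (simp only: card_relations)
  then have "card (relations x) * CARD('k) ^ rk emb x * (card (relations y) * CARD('k) ^ j)
      = card (relations y) * CARD('k) ^ rk emb y * (card (relations x) * CARD('k) ^ i)"
    using assms by simp
  then have "CARD('k) ^ (rk emb x + j) = CARD('k) ^ (rk emb y + i)"
    by (simp add: power_add mult.left_commute mult.commute)
  then show ?thesis using q_gt_1 by simp
qed

text \<open>The functionals that vanish on the kernel form the dual of the image, so there are as
  many of them as elements of the image.\<close>

lemma card_annihilator_relations: "card (annihilator (relations x)) = CARD('k) ^ rk emb x"
proof -
  have "card (relations x) * card (annihilator (relations x)) = card (relations x) * CARD('k) ^ rk emb x"
    by (simp only: card_relations card_annihilator[OF subspace_relations])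
  then show ?thesis by simp
qed

lemma rk_minus [simp]: "rk emb (- x) = rk emb x"
proof -
  have "relations (- x) = relations x" by auto
  then show ?thesis using rk_eq_if_card_relations[of "- x" 0 x 0] by simp
qed

lemma rk_0 [simp]: "rk emb 0 = 0"
proof -
  have "range (coord_map (0 :: 'l ^ 'n)) = {0}" by auto
  then have "CARD('k) ^ rk emb (0 :: 'l ^ 'n) = 1" by (metis card_range_coord_map is_singletonI is_singleton_altdef)
  then show ?thesis using q_gt_1 by simp
qed

lemma rk_eq_0_iff [simp]: "rk emb x = 0 \<longleftrightarrow> x = 0"
proof
  assume "rk emb x = 0"
  then have "card (range (coord_map x)) = 1" by (simp add: card_range_coord_map)
  then obtain a where a: "range (coord_map x) = {a}" by (metis card_1_singletonE)
  then have "coord_map x v = coord_map x 0" for v by (metis rangeI singletonD)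
  from this[of "axis _ 1"] show "x = 0" by (simp add: vec_eq_iff)
qed simp

section \<open>Vectors of rank one and their factorisations\<close>

definition rank_one :: "'l \<Rightarrow> 'k ^ 'n \<Rightarrow> 'l ^ 'n" where
  "rank_one a f = (\<chi> i. a * emb (f $ i))"

lemma coord_map_rank_one [simp]: "coord_map (rank_one a f) v = a * emb (dot f v)"
  by (simp add: coord_map_def rank_one_def dot_def emb_sum sum_distrib_left algebra_simps)

lemma rank_one_eq_0_iff [simp]: "rank_one a f = 0 \<longleftrightarrow> a = 0 \<or> f = 0"
  by (auto simp: rank_one_def vec_eq_iff)

lemma card_nonzero_scalars: "card {c :: 'k. c \<noteq> 0} = CARD('k) - 1"
  using card_Diff_singleton[of "0 :: 'k" UNIV] by (simp add: Collect_neg_eq Compl_eq_Diff_UNIV)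

lemma rk_rank_one:
  assumes "a \<noteq> 0" "f \<noteq> 0"
  shows "rk emb (rank_one a f) = 1"
proof -
  obtain v where v: "dot f v = 1" using assms(2) by (rule dot_nondegenerate)
  have "range (coord_map (rank_one a f)) = range (\<lambda>c. a * emb c)"
  proof
    show "range (\<lambda>c. a * emb c) \<subseteq> range (coord_map (rank_one a f))"
    proof (rule image_subsetI)
      fix c show "a * emb c \<in> range (coord_map (rank_one a f))"
        by (rule range_eqI[of _ _ "c *s v"]) (simp add: v)
    qed
  qed auto
  moreover have "inj (\<lambda>c. a * emb c)" using assms(1) by (auto intro: injI)
  ultimately have "CARD('k) ^ rk emb (rank_one a f) = CARD('k) ^ 1"
    by (simp only: card_range_coord_map[symmetric] card_image power_one_right)
  then show ?thesis using power_inject_exp[OF q_gt_1] by blast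
qed

text \<open>The image of a rank one vector has q elements, so it is the line through any nonzero
  coordinate, and every coordinate is a GF(q)-multiple of that one.\<close>

lemma rk_1_iff: "rk emb w = 1 \<longleftrightarrow> (\<exists>a f. a \<noteq> 0 \<and> f \<noteq> 0 \<and> w = rank_one a f)"
proof
  assume rk: "rk emb w = 1"
  then have "w \<noteq> 0" by auto
  then obtain j where j: "w $ j \<noteq> 0" by (auto simp: vec_eq_iff)
  let ?a = "w $ j"
  have "range (\<lambda>c. ?a * emb c) \<subseteq> range (coord_map w)"
  proof (rule image_subsetI)
    fix c show "?a * emb c \<in> range (coord_map w)"
      by (rule range_eqI[of _ _ "axis j c"]) (simp add: mult.commute)
  qed
  moreover have "inj (\<lambda>c. ?a * emb c)" using j by (auto intro: injI)
  ultimately have eq: "range (\<lambda>c. ?a * emb c) = range (coord_map w)"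
    using rk by (intro card_subset_eq) (auto simp: card_range_coord_map card_image)
  have "\<exists>c. w $ i = ?a * emb c" for i
  proof -
    have "w $ i = coord_map w (axis i 1)" by simp
    then have "w $ i \<in> range (\<lambda>c. ?a * emb c)" unfolding eq by (rule range_eqI)
    then show ?thesis by auto
  qed
  then obtain g where g: "\<And>i. w $ i = ?a * emb (g i)" by metis
  have "w = rank_one ?a (\<chi> i. g i)" by (simp add: rank_one_def vec_eq_iff g[symmetric])
  with \<open>w \<noteq> 0\<close> show "\<exists>a f. a \<noteq> 0 \<and> f \<noteq> 0 \<and> w = rank_one a f"
    by (metis rank_one_eq_0_iff)
qed (auto simp: rk_rank_one)

lemma rank_one_scale: "c \<noteq> 0 \<Longrightarrow> rank_one (a * emb c) (inverse c *s f) = rank_one a f"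
  by (simp add: rank_one_def vec_eq_iff)

text \<open>Evaluation of both coordinate maps at a \<open>v\<close> with \<open>dot f v = 1\<close>
  gives \<open>a = b * emb (dot g v)\<close>, so \<open>c\<close> has to be the inverse of
  \<open>dot g v\<close>.\<close>

lemma rank_one_eq_imp_scale:
  assumes "a \<noteq> 0" "f \<noteq> 0" and eq: "rank_one b g = rank_one a f"
  obtains c where "c \<noteq> 0" "b = a * emb c" "g = inverse c *s f"
proof -
  obtain v where v: "dot f v = 1" using assms(2) by (rule dot_nondegenerate)
  have "coord_map (rank_one b g) v = coord_map (rank_one a f) v" by (simp only: eq)
  then have bv: "b * emb (dot g v) = a" using v by simp
  then have c0: "dot g v \<noteq> 0" using \<open>a \<noteq> 0\<close> by auto
  define c where "c = inverse (dot g v)"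
  have c: "c \<noteq> 0" using c0 by (simp add: c_def)
  have "emb (dot g v) * emb c = 1" using c0 by (simp add: c_def)
  then have b: "b = a * emb c" using bv by (metis mult.assoc mult.right_neutral)
  have "g = inverse c *s f"
  proof (rule vec_eq_iff[THEN iffD2], rule)
    fix i
    have "b * emb (g $ i) = a * emb (f $ i)"
      using eq by (simp add: rank_one_def vec_eq_iff)
    then have "emb (c * g $ i) = emb (f $ i)" using b \<open>a \<noteq> 0\<close> by simp
    then have "c * g $ i = f $ i" by (simp only: emb_eq_iff)
    then show "g $ i = (inverse c *s f) $ i" using c by (simp add: field_simps)
  qed
  with c b show thesis by (rule that)
qed

text \<open>A rank one vector has exactly q - 1 factorisations, one for each nonzero scalar moved
  between the factors. Counting vectors thus reduces to counting pairs, which have an explicit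
  description.\<close>

lemma card_rank_one_pairs:
  fixes P :: "('l \<times> ('k ^ 'n)) set"
  assumes P: "\<And>a f. (a, f) \<in> P \<longleftrightarrow> a \<noteq> 0 \<and> f \<noteq> 0 \<and> R (rank_one a f)"
  shows "card P = (CARD('k) - 1) * card {w :: 'l ^ 'n. rk emb w = 1 \<and> R w}"
proof -
  let ?r = "\<lambda>(a, f). rank_one a f"
  have "card P = (CARD('k) - 1) * card (?r ` P)"
  proof (rule card_eq_mult_card_fibres)
    fix w assume "w \<in> ?r ` P"
    then obtain a f where af: "a \<noteq> 0" "f \<noteq> 0" "R w" "w = rank_one a f" using P by auto
    have "bij_betw (\<lambda>c. (a * emb c, inverse c *s f)) {c. c \<noteq> 0} {p \<in> P. ?r p = w}"
    proof (rule bij_betw_imageI)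
      show "inj_on (\<lambda>c. (a * emb c, inverse c *s f)) {c. c \<noteq> 0}"
        using af by (auto intro!: inj_onI)
      show "(\<lambda>c. (a * emb c, inverse c *s f)) ` {c. c \<noteq> 0} = {p \<in> P. ?r p = w}"
      proof (intro subset_antisym image_subsetI subsetI)
        fix c :: 'k assume "c \<in> {c. c \<noteq> 0}"
        then show "(a * emb c, inverse c *s f) \<in> {p \<in> P. ?r p = w}"
          using af by (auto simp: P rank_one_scale)
      next
        fix p assume p: "p \<in> {p \<in> P. ?r p = w}"
        obtain b g where bg: "p = (b, g)" by (cases p)
        with p af have "rank_one b g = rank_one a f" by auto
        from rank_one_eq_imp_scale[OF af(1,2) this] obtain c
          where "c \<noteq> 0" "b = a * emb c" "g = inverse c *s f" .
        then show "p \<in> (\<lambda>c. (a * emb c, inverse c *s f)) ` {c. c \<noteq> 0}"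
          using bg by auto
      qed
    qed
    then show "card {p \<in> P. ?r p = w} = CARD('k) - 1"
      by (simp add: bij_betw_same_card[symmetric] card_nonzero_scalars)
  qed simp
  moreover have "?r ` P = {w. rk emb w = 1 \<and> R w}"
  proof (intro subset_antisym image_subsetI subsetI)
    fix p assume "p \<in> P"
    then show "?r p \<in> {w. rk emb w = 1 \<and> R w}"
      by (cases p) (simp add: P rk_rank_one)
  next
    fix w assume w: "w \<in> {w :: 'l ^ 'n. rk emb w = 1 \<and> R w}"
    then have "rk emb w = 1" by simp
    then obtain a f where "a \<noteq> 0" "f \<noteq> 0" "w = rank_one a f" unfolding rk_1_iff by blast
    with w show "w \<in> ?r ` P" by (intro image_eqI[of _ _ "(a, f)"]) (auto simp: P)
  qed
  ultimately show ?thesis by simp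
qed

section \<open>Rank one perturbations\<close>

text \<open>A functional that vanishes on the kernel factors through the image.\<close>

lemma annihilator_relations_dot_eq:
  assumes "f \<in> annihilator (relations x)" "coord_map x v = coord_map x w"
  shows "dot f v = dot f w"
proof -
  have "v - w \<in> relations x" using assms(2) by simp
  with assms(1) have "dot f (v - w) = 0" by (auto simp: annihilator_def simp del: dot_simps)
  then show ?thesis by simp
qed

text \<open>A new relation with \<open>dot f v\<close> nonzero could be solved for \<open>a\<close>,
  which would put \<open>a\<close> into the image.\<close>

lemma relations_add_rank_one:
  assumes a: "a \<notin> range (coord_map x)"
  shows "relations (x + rank_one a f) = {v \<in> relations x. dot f v = 0}"
proof (intro set_eqI iffI)
  fix v assume "v \<in> relations (x + rank_one a f)"
  then have v: "coord_map x v + a * emb (dot f v) = 0" by simp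
  have "dot f v = 0"
  proof (rule ccontr)
    assume "dot f v \<noteq> 0"
    then have "emb (dot f v) \<noteq> 0" by simp
    then have "a = coord_map x (- inverse (dot f v) *s v)"
      using v by (simp add: field_simps eq_neg_iff_add_eq_0)
    with a show False by blast
  qed
  with v show "v \<in> {v \<in> relations x. dot f v = 0}" by simp
qed simp

lemma rk_add_rank_one_up:
  assumes a: "a \<notin> range (coord_map x)" and f: "f \<notin> annihilator (relations x)"
  shows "rk emb (x + rank_one a f) = rk emb x + 1"
proof -
  obtain w where w: "w \<in> relations x" "dot f w \<noteq> 0" using f by (auto simp: annihilator_def)
  have "card (relations x) = CARD('k) * card (relations (x + rank_one a f))"
    unfolding relations_add_rank_one[OF a] by (rule card_hyperplane[OF subspace_relations w])
  then show ?thesis using rk_eq_if_card_relations[of "x + rank_one a f" 1 x 0] by simp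
qed

text \<open>The value -1 turns \<open>v0\<close> into a relation of the perturbed vector, and the
  old kernel is the hyperplane of the new one on which \<open>f\<close> vanishes.\<close>

lemma rk_add_rank_one_down:
  assumes v0: "dot f v0 = - 1" "coord_map x v0 \<noteq> 0" and f: "f \<in> annihilator (relations x)"
  shows "rk emb (x + rank_one (coord_map x v0) f) + 1 = rk emb x"
proof -
  let ?y = "x + rank_one (coord_map x v0) f"
  have eq: "{v \<in> relations ?y. dot f v = 0} = relations x"
    using f by (auto simp: annihilator_def)
  have "card (relations ?y) = CARD('k) * card {v \<in> relations ?y. dot f v = 0}"
    by (rule card_hyperplane[OF subspace_relations, of v0]) (use v0 in auto)
  then show ?thesis
    unfolding eq using rk_eq_if_card_relations[of ?y 0 x 1] by simp
qed

text \<open>If \<open>a\<close> is in the image and \<open>f\<close> does not vanish on the kernel,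
  the image is unchanged. In the opposite case the kernel is unchanged.\<close>

lemma rk_add_rank_one_same:
  assumes "a \<in> range (coord_map x) \<longleftrightarrow> f \<notin> annihilator (relations x)"
  shows "rk emb (x + rank_one a f) = rk emb x"
proof (cases "a \<in> range (coord_map x)")
  case True
  let ?y = "x + rank_one a f"
  obtain v0 where v0: "a = coord_map x v0" using True by auto
  obtain w where w: "w \<in> relations x" "dot f w \<noteq> 0" using True assms by (auto simp: annihilator_def)
  have "range (coord_map ?y) = range (coord_map x)"
  proof (intro subset_antisym image_subsetI)
    fix v
    show "coord_map ?y v \<in> range (coord_map x)"
      \<comment> \<open>The added multiple of \<open>v0\<close> accounts for the term
        \<open>a * emb (dot f v)\<close>.\<close>
      by (rule range_eqI[of _ _ "v + dot f v *s v0"]) (simp add: v0)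
    show "coord_map x v \<in> range (coord_map ?y)"
      \<comment> \<open>Moving along \<open>w\<close> in the kernel keeps the value of
        \<open>coord_map x\<close> and brings \<open>f\<close> to 0, so the perturbation vanishes
        there.\<close>
      by (rule range_eqI[of _ _ "v - (dot f v / dot f w) *s w"]) (use w in simp)
  qed
  then have "CARD('k) ^ rk emb ?y = CARD('k) ^ rk emb x"
    by (simp only: card_range_coord_map[symmetric])
  then show ?thesis using power_inject_exp[OF q_gt_1] by blast
next
  case False
  then have "f \<in> annihilator (relations x)" using assms by blast
  then have "relations (x + rank_one a f) = relations x"
    unfolding relations_add_rank_one[OF False] by (auto simp: annihilator_def)
  then show ?thesis using rk_eq_if_card_relations[of "x + rank_one a f" 0 x 0] by simp
qed

text \<open>A new relation \<open>v\<close> makes \<open>v + dot f v *s v0\<close> an old one.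
  Applying \<open>f\<close> gives \<open>dot f v * (1 + dot f v0) = 0\<close>, so
  \<open>dot f v\<close> is 0 and the kernel is unchanged.\<close>

lemma rk_add_rank_one_same':
  assumes v0: "dot f v0 \<noteq> - 1" and f: "f \<in> annihilator (relations x)"
  shows "rk emb (x + rank_one (coord_map x v0) f) = rk emb x"
proof -
  let ?y = "x + rank_one (coord_map x v0) f"
  have "relations ?y = relations x"
  proof (intro set_eqI iffI)
    fix v assume "v \<in> relations ?y"
    then have "v + dot f v *s v0 \<in> relations x" by (simp add: mult.commute)
    with f have "dot f (v + dot f v *s v0) = 0" by (auto simp: annihilator_def simp del: dot_simps)
    then have "dot f v * (1 + dot f v0) = 0" by (simp add: algebra_simps)
    then have "dot f v = 0" using v0 by (auto simp: add_eq_0_iff)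
    with \<open>v \<in> relations ?y\<close> show "v \<in> relations x" by simp
  next
    fix v assume "v \<in> relations x"
    with f show "v \<in> relations ?y" by (simp add: annihilator_def)
  qed
  then show ?thesis using rk_eq_if_card_relations[of ?y 0 x 0] by simp
qed

text \<open>The split is by whether \<open>f\<close> vanishes on the kernel and whether
  \<open>a\<close> lies in the image. If both hold, the value of \<open>f\<close> on the preimages
  of \<open>a\<close>, which is well defined, decides.\<close>

lemma rk_add_rank_one_cases:
  assumes "a \<noteq> 0"
  obtains (up) "a \<notin> range (coord_map x)" "f \<notin> annihilator (relations x)"
      "rk emb (x + rank_one a f) = rk emb x + 1"
    | (down) v0 where "f \<in> annihilator (relations x)" "a = coord_map x v0" "dot f v0 = - 1"
      "rk emb (x + rank_one a f) + 1 = rk emb x"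
    | (same) "a \<in> range (coord_map x) \<or> f \<in> annihilator (relations x)"
      "\<And>v0. f \<in> annihilator (relations x) \<Longrightarrow> a = coord_map x v0 \<Longrightarrow> dot f v0 \<noteq> - 1"
      "rk emb (x + rank_one a f) = rk emb x"
proof (cases "f \<in> annihilator (relations x)")
  case f: True
  show thesis
  proof (cases "a \<in> range (coord_map x)")
    case True
    then obtain v0 where v0: "a = coord_map x v0" by auto
    show thesis
    proof (cases "dot f v0 = - 1")
      case True
      then show thesis using f v0 rk_add_rank_one_down[of f v0 x] assms by (intro down) auto
    next
      case False
      have "dot f w \<noteq> - 1" if "a = coord_map x w" for w
        using annihilator_relations_dot_eq[OF f, of v0 w] that v0 False by simp
      then show thesis
        using f v0 rk_add_rank_one_same'[OF False f] by (intro same) auto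
    qed
  next
    case False
    then show thesis using f rk_add_rank_one_same[of a x f] by (intro same) auto
  qed
next
  case False
  then show thesis using up same rk_add_rank_one_up[of a x f] rk_add_rank_one_same[of a x f] by blast
qed

lemma rk_add_le:
  assumes "rk emb w \<le> 1"
  shows "rk emb (x + w) \<le> rk emb x + 1"
proof (cases "w = 0")
  case False
  then have "rk emb w \<noteq> 0" by simp
  with assms have "rk emb w = 1" by linarith
  then obtain a f where "a \<noteq> 0" "w = rank_one a f" unfolding rk_1_iff by blast
  then show ?thesis by (cases rule: rk_add_rank_one_cases[of a x f]) simp_all
qed simp

lemma rk_le_rk_add:
  assumes "rk emb w \<le> 1"
  shows "rk emb x \<le> rk emb (x + w) + 1"
  using rk_add_le[of "- w" "x + w"] assms by simp

text \<open>The pairs that raise the rank form a product of two complements. The image and the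
  annihilator of the kernel both have q^(rk x) elements and contain 0.\<close>

lemma card_rk_up:
  fixes x :: "'l ^ 'n"
  shows "(CARD('k) - 1) * card {w. rk emb w = 1 \<and> rk emb (x + w) = rk emb x + 1}
    = (CARD('l) - CARD('k) ^ rk emb x) * (CARD('k) ^ CARD('n) - CARD('k) ^ rk emb x)"
proof -
  let ?P = "(- range (coord_map x)) \<times> (- annihilator (relations x))"
  have "card ?P = (CARD('k) - 1) * card {w. rk emb w = 1 \<and> rk emb (x + w) = rk emb x + 1}"
  proof (rule card_rank_one_pairs)
    fix a f
    have "0 \<in> range (coord_map x)" by (rule range_eqI[of _ _ 0]) simp
    then have a: "a \<noteq> 0" if "a \<notin> range (coord_map x)" using that by auto
    have f: "f \<noteq> 0" if "f \<notin> annihilator (relations x)" using that by (auto simp: annihilator_def)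
    show "(a, f) \<in> ?P \<longleftrightarrow> a \<noteq> 0 \<and> f \<noteq> 0 \<and> rk emb (x + rank_one a f) = rk emb x + 1"
    proof
      assume "(a, f) \<in> ?P"
      then show "a \<noteq> 0 \<and> f \<noteq> 0 \<and> rk emb (x + rank_one a f) = rk emb x + 1"
        using a f rk_add_rank_one_up[of a x f] by blast
    next
      assume "a \<noteq> 0 \<and> f \<noteq> 0 \<and> rk emb (x + rank_one a f) = rk emb x + 1"
      then have "a \<noteq> 0" "rk emb (x + rank_one a f) = rk emb x + 1" by auto
      then show "(a, f) \<in> ?P" by (cases rule: rk_add_rank_one_cases[of a x f]) auto
    qed
  qed
  then show ?thesis
    by (simp add: card_cartesian_product Compl_eq_Diff_UNIV card_Diff_subset card_range_coord_map card_annihilator_relations)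
qed

text \<open>Each nonzero \<open>a\<close> in the image is paired with the functionals of value -1 on
  its preimages, a level set of index q in the annihilator of the kernel. At rank 0 the first factor
  vanishes, so the truncated exponent is harmless.\<close>

lemma card_rk_down:
  fixes x :: "'l ^ 'n"
  shows "(CARD('k) - 1) * card {w. rk emb w = 1 \<and> rk emb (x + w) + 1 = rk emb x}
    = (CARD('k) ^ rk emb x - 1) * CARD('k) ^ (rk emb x - 1)"
proof -
  let ?F = "\<lambda>a. {f \<in> annihilator (relations x). \<forall>v. coord_map x v = a \<longrightarrow> dot f v = - 1}"
  let ?P = "SIGMA a : range (coord_map x) - {0}. ?F a"
  have "card ?P = (CARD('k) - 1) * card {w. rk emb w = 1 \<and> rk emb (x + w) + 1 = rk emb x}"
  proof (rule card_rank_one_pairs)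
    fix a f
    show "(a, f) \<in> ?P \<longleftrightarrow> a \<noteq> 0 \<and> f \<noteq> 0 \<and> rk emb (x + rank_one a f) + 1 = rk emb x"
    proof
      assume P: "(a, f) \<in> ?P"
      then obtain v0 where v0: "a = coord_map x v0" by auto
      with P have "dot f v0 = - 1" by auto
      moreover from this have "f \<noteq> 0" by auto
      ultimately show "a \<noteq> 0 \<and> f \<noteq> 0 \<and> rk emb (x + rank_one a f) + 1 = rk emb x"
        using v0 P rk_add_rank_one_down[of f v0 x] by blast
    next
      assume "a \<noteq> 0 \<and> f \<noteq> 0 \<and> rk emb (x + rank_one a f) + 1 = rk emb x"
      then have "a \<noteq> 0" "rk emb (x + rank_one a f) + 1 = rk emb x" by auto
      then show "(a, f) \<in> ?P"
      proof (cases rule: rk_add_rank_one_cases[of a x f])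
        case (down v0)
        then have "dot f v = - 1" if "coord_map x v = a" for v
          using annihilator_relations_dot_eq[OF down(1), of v v0] that by simp
        with down \<open>a \<noteq> 0\<close> show ?thesis by auto
      qed auto
    qed
  qed
  moreover have "card (?F a) = CARD('k) ^ (rk emb x - 1)" if a: "a \<in> range (coord_map x) - {0}" for a
  proof -
    obtain v0 where v0: "a = coord_map x v0" using a by auto
    with a have "v0 \<notin> relations x" by simp
    \<comment> \<open>This \<open>g\<close> shows that evaluation at \<open>v0\<close> is not zero
      on the annihilator, as \<open>card_hyperplane\<close> requires.\<close>
    then obtain g where g: "g \<in> annihilator (relations x)" "dot g v0 \<noteq> 0"
      by (rule annihilator_separates[OF subspace_relations])
    have "?F a = {f \<in> annihilator (relations x). dot v0 f = - 1}"
    proof (intro set_eqI iffI)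
      fix f assume "f \<in> ?F a"
      with v0 show "f \<in> {f \<in> annihilator (relations x). dot v0 f = - 1}"
        by (simp add: dot_commute[of v0])
    next
      fix f assume "f \<in> {f \<in> annihilator (relations x). dot v0 f = - 1}"
      then have f: "f \<in> annihilator (relations x)" "dot f v0 = - 1"
        by (simp_all add: dot_commute[of v0])
      have "dot f v = - 1" if "coord_map x v = a" for v
        using annihilator_relations_dot_eq[OF f(1), of v v0] that v0 f(2) by simp
      with f(1) show "f \<in> ?F a" by blast
    qed
    then have eq: "CARD('k) ^ rk emb x = CARD('k) * card (?F a)"
      using card_hyperplane[OF subspace_annihilator g(1), of v0 "- 1"] g(2)
      by (simp add: card_annihilator_relations dot_commute[of v0])
    show ?thesis
    proof (cases "rk emb x")
      \<comment> \<open>Impossible, since \<open>eq\<close> would make 1 a multiple of q.\<close>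
      case 0
      then show ?thesis using eq q_gt_1 by simp
    next
      case (Suc r)
      then show ?thesis using eq by simp
    qed
  qed
  moreover have "0 \<in> range (coord_map x)" by (rule range_eqI[of _ _ 0]) simp
  ultimately show ?thesis
    by (simp add: card_SigmaI card_Diff_singleton card_range_coord_map)
qed

section \<open>Gaussian brackets, intersection numbers and ball volumes\<close>

lemma q_bracket_mult: "q_bracket CARD('k) k * (real CARD('k) - 1) = real CARD('k) ^ k - 1"
  using q_gt_1 by (simp add: q_bracket_def)

lemma q_bracket_mono: "k \<le> l \<Longrightarrow> q_bracket CARD('k) k \<le> q_bracket CARD('k) l"
  using q_gt_1 by (simp add: q_bracket_def divide_right_mono power_increasing)

lemma q_bracket_0 [simp]: "q_bracket CARD('k) 0 = 0"
  by (simp add: q_bracket_def)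

lemma q_bracket_pos: "k > 0 \<Longrightarrow> q_bracket CARD('k) k > 0"
  using q_gt_1 by (simp add: q_bracket_def)

lemma real_card_rk_up:
  fixes x :: "'l ^ 'n"
  shows "real (card {w. rk emb w = 1 \<and> rk emb (x + w) = rk emb x + 1})
    = (real CARD('l) - real CARD('k) ^ rk emb x)
      * (q_bracket CARD('k) CARD('n) - q_bracket CARD('k) (rk emb x))"
proof -
  \<comment> \<open>This bound and the next make the subtractions of naturals in
    \<open>card_rk_up\<close> agree with real ones.\<close>
  have "CARD('k) ^ rk emb x \<le> CARD('l)"
    unfolding card_range_coord_map[symmetric] by (rule card_mono) auto
  moreover have "CARD('k) ^ rk emb x \<le> CARD('k) ^ CARD('n)"
    using card_mono[of UNIV "annihilator (relations x)"]
    by (simp add: card_annihilator_relations)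
  ultimately have "(real CARD('k) - 1)
      * real (card {w. rk emb w = 1 \<and> rk emb (x + w) = rk emb x + 1})
    = (real CARD('l) - real CARD('k) ^ rk emb x)
      * (real CARD('k) ^ CARD('n) - real CARD('k) ^ rk emb x)"
    using arg_cong[OF card_rk_up[of x], of real] q_gt_1 by (simp add: of_nat_diff)
  also have "real CARD('k) ^ CARD('n) - real CARD('k) ^ rk emb x
    = (real CARD('k) - 1) * (q_bracket CARD('k) CARD('n) - q_bracket CARD('k) (rk emb x))"
    using q_bracket_mult[of "CARD('n)"] q_bracket_mult[of "rk emb x"] by (simp add: algebra_simps)
  finally show ?thesis using q_gt_1 by simp
qed

lemma real_card_rk_down:
  fixes x :: "'l ^ 'n"
  shows "real (card {w. rk emb w = 1 \<and> rk emb (x + w) + 1 = rk emb x})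
    = real CARD('k) ^ (rk emb x - 1) * q_bracket CARD('k) (rk emb x)"
proof -
  have "(real CARD('k) - 1)
      * real (card {w. rk emb w = 1 \<and> rk emb (x + w) + 1 = rk emb x})
    = (real CARD('k) ^ rk emb x - 1) * real CARD('k) ^ (rk emb x - 1)"
    using arg_cong[OF card_rk_down[of x], of real] q_gt_1 by (simp add: of_nat_diff)
  also have "\<dots> = (real CARD('k) - 1) *
      (real CARD('k) ^ (rk emb x - 1) * q_bracket CARD('k) (rk emb x))"
    by (simp only: q_bracket_mult[symmetric] mult_ac)
  finally show ?thesis using q_gt_1 by simp
qed

lemma rk_le_1_cases:
  assumes "rk emb w \<le> 1"
  obtains "w = 0" | "rk emb w = 1"
  using assms by (metis One_nat_def le_Suc_eq le_zero_eq rk_eq_0_iff)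

abbreviation unit_ball :: "('l ^ 'n) set" where
  "unit_ball \<equiv> {w. rk emb w \<le> 1}"

text \<open>The intersection number for a centre at distance exactly the radius: the points of the
  unit ball that get lost are those of the rank-raising \<open>w\<close>.\<close>

lemma card_unit_ball_inter_eq:
  fixes u :: "'l ^ 'n"
  shows "real (card {w \<in> unit_ball. rk emb (u + w) \<le> rk emb u})
    = real (card (unit_ball :: ('l ^ 'n) set)) - (real CARD('l) - real CARD('k) ^ rk emb u)
      * (q_bracket CARD('k) CARD('n) - q_bracket CARD('k) (rk emb u))"
proof -
  let ?U = "{w. rk emb w = 1 \<and> rk emb (u + w) = rk emb u + 1}"
  have "unit_ball = {w \<in> unit_ball. rk emb (u + w) \<le> rk emb u} \<union> ?U"
    using rk_add_le[of _ u] by (auto elim!: rk_le_1_cases simp: le_Suc_eq)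
  moreover have "{w \<in> unit_ball. rk emb (u + w) \<le> rk emb u} \<inter> ?U = {}" by auto
  ultimately have "card (unit_ball :: ('l ^ 'n) set)
    = card {w \<in> unit_ball. rk emb (u + w) \<le> rk emb u} + card ?U"
    by (metis (no_types, lifting) card_Un_disjoint finite)
  then show ?thesis by (simp only: real_card_rk_up[symmetric] of_nat_add)
qed

text \<open>The intersection number for a centre one step too far away: a point of the unit ball is
  covered only if its \<open>w\<close> lowers the rank.\<close>

lemma card_unit_ball_inter_Suc:
  fixes u :: "'l ^ 'n"
  assumes "rk emb u = \<rho> + 1"
  shows "real (card {w \<in> unit_ball. rk emb (u + w) \<le> \<rho>})
    = real CARD('k) ^ \<rho> * q_bracket CARD('k) (\<rho> + 1)"
proof -
  have "rk emb w = 1 \<and> rk emb (u + w) = \<rho>" if "rk emb w \<le> 1" "rk emb (u + w) \<le> \<rho>" for w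
  proof (rule rk_le_1_cases[OF that(1)])
    assume "w = 0"
    then show ?thesis using that(2) assms by simp
  next
    assume "rk emb w = 1"
    then show ?thesis using that(2) rk_le_rk_add[OF that(1), of u] assms by simp
  qed
  then have "{w \<in> unit_ball. rk emb (u + w) \<le> \<rho>} = {w. rk emb w = 1 \<and> rk emb (u + w) + 1 = rk emb u}"
    using assms by auto
  then show ?thesis using real_card_rk_down[of u] assms by simp
qed

lemma unit_ball_inter_gt:
  assumes "rk emb u > \<rho> + 1"
  shows "{w \<in> unit_ball. rk emb (u + w) \<le> \<rho>} = {}"
  using assms rk_le_rk_add[of _ u] by fastforce

lemma ball_volume_eq_card:
  "ball_volume emb TYPE('n::finite) r = card {x :: 'l ^ 'n. rk emb x \<le> r}"
proof -
  have "card (\<Union>u\<in>{0..r}. {x :: 'l ^ 'n. rk emb x = u}) = (\<Sum>u\<in>{0..r}. card {x :: 'l ^ 'n. rk emb x = u})"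
    by (rule card_UN_disjoint) auto
  also have "(\<Union>u\<in>{0..r}. {x :: 'l ^ 'n. rk emb x = u}) = {x. rk emb x \<le> r}" by auto
  finally show ?thesis by (simp add: ball_volume_def rank_count_def)
qed

lemma card_translate:
  fixes c :: "'l ^ 'n"
  shows "card {y. P (y - c)} = card {y. P y}"
  by (rule bij_betw_same_card[of "\<lambda>y. y - c"])
    (rule bij_betw_byWitness[where f' = "\<lambda>y. y + c"]; auto)

lemma card_minus:
  fixes P :: "'l ^ 'n \<Rightarrow> bool"
  shows "card {y. P (- y)} = card {y. P y}"
  by (rule bij_betw_same_card[of uminus]) (rule bij_betw_byWitness[where f' = uminus]; auto)

text \<open>This bound makes the denominator \<delta> positive. Both factors of
  \<open>q^(\<rho>-1) * q_bracket q \<rho>\<close> are compared with those of v(1) - 1.\<close>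

lemma unit_ball_volume_ge:
  fixes \<rho> :: nat
  assumes "0 < \<rho>" "\<rho> \<le> CARD('n)" "CARD('k) ^ \<rho> \<le> CARD('l)"
  shows "real CARD('k) ^ (\<rho> - 1) * q_bracket CARD('k) \<rho> + 1 \<le> real (card (unit_ball :: ('l ^ 'n) set))"
proof -
  \<comment> \<open>At \<open>u = 0\<close> the intersection formula gives v(1) itself.\<close>
  have ball_0: "{w \<in> unit_ball. rk emb (0 + w) \<le> rk emb (0 :: 'l ^ 'n)} = {0}" by auto
  have v1: "real (card (unit_ball :: ('l ^ 'n) set))
      = 1 + (real CARD('l) - 1) * q_bracket CARD('k) CARD('n)"
    using card_unit_ball_inter_eq[of "0 :: 'l ^ 'n"] unfolding ball_0 by simp
  obtain r where r: "\<rho> = Suc r" using assms(1) by (cases \<rho>) auto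
  have "1 * 1 \<le> (CARD('k) - 1) * CARD('k) ^ r" using q_gt_1 by (intro mult_le_mono) auto
  then have "CARD('k) ^ r + 1 \<le> CARD('l)"
    using assms(3) r by (simp add: diff_mult_distrib)
  then have "real (CARD('k) ^ r + 1) \<le> real CARD('l)" by (simp only: of_nat_le_iff)
  then have "real CARD('k) ^ (\<rho> - 1) \<le> real CARD('l) - 1"
    using r by simp
  moreover have "q_bracket CARD('k) \<rho> \<le> q_bracket CARD('k) CARD('n)"
    using assms(2) by (rule q_bracket_mono)
  moreover have "q_bracket CARD('k) \<rho> \<ge> 0" using q_bracket_pos[OF assms(1)] by simp
  ultimately show ?thesis unfolding v1 by (simp add: mult_mono)
qed

end

section \<open>The excess of a covering\<close>

text \<open>The last bound in \<open>radius\<close> expresses \<rho> \<le> m without naming the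
  degree m.\<close>

locale rank_covering = finite_field_embedding emb
  for emb :: "'k::{field,finite} \<Rightarrow> 'l::{field,finite}" +
  fixes C :: "('l ^ 'n) set" and \<rho> :: nat
  assumes covers: "\<exists>c\<in>C. rk emb (x - c) \<le> \<rho>"
    and radius: "0 < \<rho>" "\<rho> \<le> CARD('n)" "CARD('k) ^ \<rho> \<le> CARD('l)"
begin

definition covering_number :: "'l ^ 'n \<Rightarrow> nat" where
  "covering_number x = card {c \<in> C. rk emb (x - c) \<le> \<rho>}"

definition excess :: "'l ^ 'n \<Rightarrow> real" where
  "excess x = real (covering_number x) - 1"

definition tight :: "('l ^ 'n) set" where
  "tight = {x. covering_number x = 1 \<and> (\<exists>c\<in>C. rk emb (x - c) = \<rho>)}"

text \<open>The number of rank one vectors that raise the rank of a given vector of rank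
  \<rho>.\<close>

definition up_count :: real where
  "up_count = (real CARD('l) - real CARD('k) ^ \<rho>)
    * (q_bracket CARD('k) CARD('n) - q_bracket CARD('k) \<rho>)"

text \<open>The number of rank one vectors that lower the rank of a given vector of rank \<rho> +
  1.\<close>

definition down_count :: real where
  "down_count = real CARD('k) ^ \<rho> * q_bracket CARD('k) (\<rho> + 1)"

text \<open>The least nonnegative value of \<open>B * down_count - up_count\<close> over the
  integers B.\<close>

definition \<epsilon> :: real where
  "\<epsilon> = of_int \<lceil>up_count / down_count\<rceil> * down_count - up_count"

text \<open>The size of a unit ball without its centre and without the neighbours that are closer to
  a codeword at distance \<rho> from the centre.\<close>

definition \<Delta> :: real where
  "\<Delta> = real (card (unit_ball :: ('l ^ 'n) set)) - real CARD('k) ^ (\<rho> - 1) * q_bracket CARD('k) \<rho> - 1"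

lemma covering_number_ge_1: "covering_number x \<ge> 1"
  using covers[of x] by (auto simp: covering_number_def Suc_le_eq card_gt_0_iff)

lemma excess_nonneg: "excess x \<ge> 0"
  using covering_number_ge_1[of x] by (simp add: excess_def)

lemma down_count_pos: "down_count > 0"
  using q_bracket_pos[of "\<rho> + 1"] by (simp add: down_count_def)

lemma \<Delta>_nonneg: "\<Delta> \<ge> 0"
  using unit_ball_volume_ge[OF radius] by (simp add: \<Delta>_def)

lemma sum_excess: "(\<Sum>x\<in>UNIV. excess x)
  = real (card C) * real (ball_volume emb TYPE('n) \<rho>) - real CARD('l) ^ CARD('n)"
proof -
  have "(\<Sum>x\<in>UNIV. covering_number x) = card {x :: 'l ^ 'n. rk emb x \<le> \<rho>} * card C"
    unfolding covering_number_def
    by (rule sum_multicount) (auto simp: card_translate[of "\<lambda>x. rk emb x \<le> \<rho>"])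
  then have "(\<Sum>x\<in>UNIV. real (covering_number x)) = real (card C) * real (ball_volume emb TYPE('n) \<rho>)"
    by (simp add: ball_volume_eq_card flip: of_nat_sum)
  then show ?thesis by (simp add: excess_def sum_subtractf)
qed

text \<open>The sum is split by codewords: the one covering \<open>x\<close> misses
  \<open>up_count\<close> points of the unit ball, each one at distance \<rho> + 1 covers
  \<open>down_count\<close> of them, and those farther away cover none.\<close>

lemma sum_excess_unit_ball_ge:
  assumes "x \<in> tight"
  shows "\<epsilon> \<le> (\<Sum>w\<in>unit_ball. excess (x + w))"
proof -
  have one: "card {c \<in> C. rk emb (x - c) \<le> \<rho>} = 1"
    using assms by (simp add: tight_def covering_number_def)
  obtain c0 where c0: "c0 \<in> C" "rk emb (x - c0) = \<rho>" using assms by (auto simp: tight_def)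
  obtain c1 where "{c \<in> C. rk emb (x - c) \<le> \<rho>} = {c1}" using one by (rule card_1_singletonE)
  then have only: "c = c0" if "c \<in> C" "rk emb (x - c) \<le> \<rho>" for c
    using c0 that by (metis (mono_tags, lifting) le_refl mem_Collect_eq singletonD)
  let ?v = "real (card (unit_ball :: ('l ^ 'n) set))"
  let ?B = "card {c \<in> C. rk emb (x - c) = \<rho> + 1}"
  have "(\<Sum>w\<in>unit_ball. covering_number (x + w))
      = (\<Sum>c\<in>C. card {w \<in> unit_ball. rk emb (x - c + w) \<le> \<rho>})"
    unfolding covering_number_def by (rule sum_multicount_gen) (auto simp: algebra_simps)
  then have "(\<Sum>w\<in>unit_ball. real (covering_number (x + w)))
      = (\<Sum>c\<in>C. real (card {w \<in> unit_ball. rk emb (x - c + w) \<le> \<rho>}))"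
    by (simp flip: of_nat_sum)
  also have "\<dots> = (\<Sum>c\<in>C. (if c = c0 then ?v - up_count else 0)
      + (if rk emb (x - c) = \<rho> + 1 then down_count else 0))"
  proof (rule sum.cong[OF refl])
    fix c assume c: "c \<in> C"
    consider "c = c0" | "c \<noteq> c0" "rk emb (x - c) = \<rho> + 1" | "c \<noteq> c0" "rk emb (x - c) > \<rho> + 1"
      using only[OF c] by linarith
    then show "real (card {w \<in> unit_ball. rk emb (x - c + w) \<le> \<rho>})
        = (if c = c0 then ?v - up_count else 0)
          + (if rk emb (x - c) = \<rho> + 1 then down_count else 0)"
    proof cases
      case 1
      then show ?thesis
        using card_unit_ball_inter_eq[of "x - c0"] c0 by (simp add: up_count_def)
    next
      case 2
      then show ?thesis using card_unit_ball_inter_Suc[of "x - c" \<rho>] by (simp add: down_count_def)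
    next
      case 3
      then show ?thesis using unit_ball_inter_gt[of \<rho> "x - c"] by simp
    qed
  qed
  also have "\<dots> = ?v - up_count + real ?B * down_count"
    using c0(1) by (simp add: sum.distrib sum.If_cases Int_def)
  finally have sum: "(\<Sum>w\<in>unit_ball. excess (x + w)) = real ?B * down_count - up_count"
    by (simp add: excess_def sum_subtractf)
  \<comment> \<open>Nonnegativity bounds \<open>?B\<close> below by a quotient, and as an integer
    \<open>?B\<close> also reaches its ceiling.\<close>
  have "0 \<le> (\<Sum>w\<in>unit_ball. excess (x + w))" by (intro sum_nonneg excess_nonneg)
  then have "up_count / down_count \<le> real ?B"
    unfolding sum using down_count_pos by (simp add: field_simps)
  then have "\<lceil>up_count / down_count\<rceil> \<le> int ?B" by (simp add: ceiling_le_iff)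
  then have "real_of_int \<lceil>up_count / down_count\<rceil> \<le> real ?B" by linarith
  then show ?thesis
    unfolding sum \<epsilon>_def using down_count_pos by (simp add: mult_right_mono)
qed

text \<open>If a codeword is at distance exactly \<rho> from \<open>y\<close>, then \<open>y\<close>
  and its neighbours closer to that codeword are not tight. Otherwise no point of the unit ball is
  tight.\<close>

lemma card_tight_unit_ball_le:
  assumes "excess y > 0"
  shows "real (card {w \<in> unit_ball. y + w \<in> tight}) \<le> \<Delta>"
proof (cases "\<exists>c\<in>C. rk emb (y - c) = \<rho>")
  case True
  then obtain c where c: "c \<in> C" "rk emb (y - c) = \<rho>" by blast
  let ?D = "{w. rk emb w = 1 \<and> rk emb (y - c + w) + 1 = rk emb (y - c)}"
  have y: "y \<notin> tight" using assms by (simp add: tight_def excess_def)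
  \<comment> \<open>Here \<open>c\<close> is at distance less than \<rho>, so a codeword at distance
    exactly \<rho> would be a second one covering the point.\<close>
  have D: "y + w \<notin> tight" if "w \<in> ?D" for w
  proof
    assume t: "y + w \<in> tight"
    then obtain c' where c': "c' \<in> C" "rk emb (y + w - c') = \<rho>" by (auto simp: tight_def)
    have eq: "y + w - c = y - c + w" by simp
    have lt: "rk emb (y + w - c) < \<rho>" using that c unfolding eq by simp
    then have "c \<noteq> c'" using c' by auto
    moreover have "{c, c'} \<subseteq> {c \<in> C. rk emb (y + w - c) \<le> \<rho>}"
      using c c' lt by simp
    then have "card {c, c'} \<le> covering_number (y + w)"
      unfolding covering_number_def by (intro card_mono) auto
    ultimately show False using t by (simp add: tight_def)
  qed
  have "{w \<in> unit_ball. y + w \<in> tight} \<union> (insert 0 ?D) \<subseteq> unit_ball" by auto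
  then have "card ({w \<in> unit_ball. y + w \<in> tight} \<union> (insert 0 ?D)) \<le> card (unit_ball :: ('l ^ 'n) set)"
    by (intro card_mono) auto
  moreover have "card ({w \<in> unit_ball. y + w \<in> tight} \<union> (insert 0 ?D))
      = card {w \<in> unit_ball. y + w \<in> tight} + card (insert 0 ?D)"
    by (rule card_Un_disjoint) (use y D in auto)
  moreover have "card (insert 0 ?D) = card ?D + 1" by simp
  ultimately have "real (card {w \<in> unit_ball. y + w \<in> tight}) + real (card ?D) + 1
      \<le> real (card (unit_ball :: ('l ^ 'n) set))"
    by linarith
  moreover have "real (card ?D) = real CARD('k) ^ (\<rho> - 1) * q_bracket CARD('k) \<rho>"
    using real_card_rk_down[of "y - c"] c(2) by simp
  ultimately show ?thesis by (simp add: \<Delta>_def)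
next
  case False
  have "y + w \<notin> tight" if "w \<in> unit_ball" for w
  proof
    assume t: "y + w \<in> tight"
    \<comment> \<open>The codewords covering \<open>y\<close> all do so at distance below \<rho>, so
      they still cover every neighbour, which inherits the positive excess.\<close>
    have "{c \<in> C. rk emb (y - c) \<le> \<rho>} \<subseteq> {c \<in> C. rk emb (y + w - c) \<le> \<rho>}"
    proof clarify
      fix c assume "c \<in> C" "rk emb (y - c) \<le> \<rho>"
      with False have "rk emb (y - c) < \<rho>" by force
      then show "rk emb (y + w - c) \<le> \<rho>"
        using rk_add_le[of w "y - c"] that by (simp add: algebra_simps)
    qed
    then have "covering_number y \<le> covering_number (y + w)"
      unfolding covering_number_def by (intro card_mono) auto
    with t assms show False by (simp add: tight_def excess_def)
  qed
  then have empty: "{w \<in> unit_ball. y + w \<in> tight} = {}" by blast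
  show ?thesis unfolding empty using \<Delta>_nonneg by simp
qed

text \<open>The excess of \<open>x + w\<close> is summed over tight \<open>x\<close> and
  \<open>w\<close> in the unit ball. Each tight \<open>x\<close> yields at least
  \<open>\<epsilon>\<close>, while each point of positive excess is reached from at most
  \<open>\<Delta>\<close> tight points.\<close>

lemma card_tight_le: "\<epsilon> * real (card tight) \<le> \<Delta> * (\<Sum>x\<in>UNIV. excess x)"
proof -
  have "\<epsilon> * real (card tight) = (\<Sum>x\<in>tight. \<epsilon>)" by simp
  also have "\<dots> \<le> (\<Sum>x\<in>tight. \<Sum>w\<in>unit_ball. excess (x + w))"
    by (intro sum_mono sum_excess_unit_ball_ge)
  also have "\<dots> = (\<Sum>w\<in>unit_ball. \<Sum>x\<in>UNIV. if x \<in> tight then excess (x + w) else 0)"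
    by (subst sum.swap) (simp add: sum.If_cases)
  also have "\<dots> = (\<Sum>w\<in>unit_ball. \<Sum>y\<in>UNIV. if y - w \<in> tight then excess y else 0)"
  proof (rule sum.cong[OF refl])
    fix w :: "'l ^ 'n"
    have "bij_betw (\<lambda>y. y - w) UNIV UNIV"
      by (rule bij_betw_byWitness[where f' = "\<lambda>y. y + w"]) auto
    from sum.reindex_bij_betw[OF this, of "\<lambda>x. if x \<in> tight then excess (x + w) else 0"]
    show "(\<Sum>x\<in>UNIV. if x \<in> tight then excess (x + w) else 0)
        = (\<Sum>y\<in>UNIV. if y - w \<in> tight then excess y else 0)"
      by (simp cong: if_cong)
  qed
  also have "\<dots> = (\<Sum>y\<in>UNIV. real (card {w \<in> unit_ball. y - w \<in> tight}) * excess y)"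
    by (subst sum.swap) (simp add: sum.If_cases Int_def conj_commute)
  also have "\<dots> \<le> (\<Sum>y\<in>UNIV. \<Delta> * excess y)"
  proof (rule sum_mono)
    fix y
    \<comment> \<open>The unit ball is symmetric under negation.\<close>
    have "card {w \<in> unit_ball. y - w \<in> tight} = card {w \<in> unit_ball. y + w \<in> tight}"
      using card_minus[of "\<lambda>w. w \<in> unit_ball \<and> y + w \<in> tight"] by simp
    then show "real (card {w \<in> unit_ball. y - w \<in> tight}) * excess y \<le> \<Delta> * excess y"
      using card_tight_unit_ball_le[of y] excess_nonneg[of y]
      by (cases "excess y = 0") (auto intro: mult_right_mono)
  qed
  finally show ?thesis by (simp add: sum_distrib_left)
qed

text \<open>The bound holds pointwise: a point of excess 0 has a codeword at distance \<rho> only if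
  it is tight, and then just one. A point of excess e \<ge> 1 has at most e + 1 \<le> 2 e of
  them.\<close>

lemma rank_count_le:
  "real (card C) * real (rank_count emb TYPE('n) \<rho>) \<le> real (card tight) + 2 * (\<Sum>x\<in>UNIV. excess x)"
proof -
  have "(\<Sum>x\<in>UNIV. card {c \<in> C. rk emb (x - c) = \<rho>}) = card {x :: 'l ^ 'n. rk emb x = \<rho>} * card C"
    by (rule sum_multicount) (auto simp: card_translate[of "\<lambda>x. rk emb x = \<rho>"])
  then have "real (card C) * real (rank_count emb TYPE('n) \<rho>)
      = (\<Sum>x\<in>UNIV. real (card {c \<in> C. rk emb (x - c) = \<rho>}))"
    by (simp add: rank_count_def flip: of_nat_sum)
  also have "\<dots> \<le> (\<Sum>x\<in>UNIV. (if x \<in> tight then 1 else 0) + 2 * excess x)"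
  proof (rule sum_mono)
    fix x
    have le: "card {c \<in> C. rk emb (x - c) = \<rho>} \<le> covering_number x"
      unfolding covering_number_def by (intro card_mono) auto
    show "real (card {c \<in> C. rk emb (x - c) = \<rho>}) \<le> (if x \<in> tight then 1 else 0) + 2 * excess x"
    proof (cases "covering_number x = 1")
      case True
      show ?thesis
      proof (cases "x \<in> tight")
        case False
        with True have "{c \<in> C. rk emb (x - c) = \<rho>} = {}" by (auto simp: tight_def)
        then show ?thesis using excess_nonneg[of x] False by (simp only: card.empty) simp
      qed (use le True in \<open>simp add: excess_def\<close>)
    next
      case False
      then have "covering_number x \<ge> 2" using covering_number_ge_1[of x] by linarith
      then have "real (covering_number x) \<le> 2 * excess x" by (simp add: excess_def)
      then show ?thesis using le by simp
    qed
  qed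
  also have "\<dots> = real (card tight) + 2 * (\<Sum>x\<in>UNIV. excess x)"
    by (simp add: sum.distrib sum.If_cases sum_distrib_left)
  finally show ?thesis .
qed

lemma card_lower_bound:
  assumes "\<epsilon> > 0"
  shows "real CARD('l) ^ CARD('n) / (real (ball_volume emb TYPE('n) \<rho>)
      - \<epsilon> / (\<Delta> + 2 * \<epsilon>) * real (rank_count emb TYPE('n) \<rho>)) \<le> real (card C)"
proof -
  let ?E = "\<Sum>x\<in>UNIV. excess x"
  let ?K = "real (card C)" and ?N = "real (rank_count emb TYPE('n) \<rho>)"
  let ?v = "real (ball_volume emb TYPE('n) \<rho>)" and ?\<delta> = "\<Delta> + 2 * \<epsilon>"
  let ?d = "?v - \<epsilon> / ?\<delta> * ?N"
  have \<delta>: "?\<delta> > 0" using assms \<Delta>_nonneg by simp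
  have "\<epsilon> * (?K * ?N) \<le> \<epsilon> * (real (card tight) + 2 * ?E)"
    using assms by (intro mult_left_mono rank_count_le) simp
  also have "\<dots> \<le> ?\<delta> * ?E" using card_tight_le by (simp add: algebra_simps)
  finally have "\<epsilon> * (?K * ?N) / ?\<delta> \<le> ?E" using \<delta> by (simp add: field_simps)
  then have le: "real CARD('l) ^ CARD('n) \<le> ?K * ?d"
    unfolding sum_excess by (simp add: algebra_simps)
  \<comment> \<open>The inequality \<open>le\<close> itself forces the denominator to be positive,
    which permits the division.\<close>
  have "0 < real CARD('l) ^ CARD('n)" by simp
  with le have "0 < ?K * ?d" by linarith
  then have "?d > 0" by (simp add: zero_less_mult_iff)
  with le show ?thesis by (simp add: divide_le_eq)
qed

end

section \<open>Codes of minimum size and the final bound\<close>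

lemma K_R_attained:
  fixes emb :: "'k::{field,finite} \<Rightarrow> 'l::{field,finite}"
  assumes "field_embedding emb"
  obtains C :: "('l ^ 'n::finite) set"
  where "card C = K_R emb TYPE('n) \<rho>" "\<And>x. \<exists>c\<in>C. rk emb (x - c) \<le> \<rho>"
proof -
  interpret finite_field_embedding emb by unfold_locales (rule assms)
  let ?S = "{card C | C :: ('l ^ 'n) set. C \<noteq> {} \<and> covering_radius emb C \<le> \<rho>}"
  have "finite ?S"
    by (rule finite_subset[of _ "card ` (UNIV :: ('l ^ 'n) set set)"]) auto
  \<comment> \<open>The whole space is a code of covering radius 0, so the minimum in
    \<open>K_R\<close> is over a nonempty set and is attained.\<close>
  moreover have "Min (rank_dist emb x ` UNIV) = 0" for x :: "'l ^ 'n"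
  proof -
    have "Min (rank_dist emb x ` UNIV) \<le> rank_dist emb x x" by (intro Min_le) auto
    then show ?thesis by (simp add: rank_dist_def)
  qed
  then have "covering_radius emb (UNIV :: ('l ^ 'n) set) \<le> \<rho>" by (simp add: covering_radius_def)
  then have "card (UNIV :: ('l ^ 'n) set) \<in> ?S" by blast
  then have "?S \<noteq> {}" by blast
  ultimately have "K_R emb TYPE('n) \<rho> \<in> ?S" unfolding K_R_def by (rule Min_in)
  then obtain C :: "('l ^ 'n) set"
    where C: "K_R emb TYPE('n) \<rho> = card C" "C \<noteq> {}" "covering_radius emb C \<le> \<rho>" by blast
  have "\<exists>c\<in>C. rk emb (x - c) \<le> \<rho>" for x
  proof -
    have "Min (rank_dist emb x ` C) \<in> rank_dist emb x ` C" using C(2) by (intro Min_in) auto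
    then obtain c where c: "c \<in> C" "Min (rank_dist emb x ` C) = rank_dist emb x c" by auto
    have "rank_dist emb x c \<le> covering_radius emb C"
      unfolding covering_radius_def c(2)[symmetric] by (intro Max_ge) auto
    with C(3) have "rk emb (x - c) \<le> \<rho>" by (simp add: rank_dist_def)
    with c(1) show ?thesis by blast
  qed
  with C(1)[symmetric] show thesis by (rule that)
qed

theorem proposition8:
  fixes emb :: "'k::{field,finite} \<Rightarrow> 'l::{field,finite}"
    and q m n \<rho> :: nat
    and \<epsilon> \<delta> :: real
  assumes "primepow q"
    and "field_embedding emb"
    and "CARD('k) = q"
    and "CARD('l) = q ^ m"
    and "CARD('n::finite) = n"
    and "0 < \<rho>" and "\<rho> < n" and "n \<le> m"
    and "\<epsilon> =
      of_int \<lceil>((real q ^ m - real q ^ \<rho>) * (q_bracket q n - q_bracket q \<rho>))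
               / (real q ^ \<rho> * q_bracket q (\<rho> + 1))\<rceil>
        * (real q ^ \<rho> * q_bracket q (\<rho> + 1))
      + (real q ^ m - real q ^ \<rho>) * (q_bracket q \<rho> - q_bracket q n)"
    and "\<delta> =
      real (ball_volume emb TYPE('n) 1) - real q ^ (\<rho> - 1) * q_bracket q \<rho> - 1 + 2 * \<epsilon>"
    and "\<epsilon> > 0"
  shows "real (K_R emb TYPE('n) \<rho>) \<ge>
    real q ^ (m * n) /
      (real (ball_volume emb TYPE('n) \<rho>) - \<epsilon> / \<delta> * real (rank_count emb TYPE('n) \<rho>))"
proof -
  obtain C :: "('l ^ 'n) set"
    where C: "card C = K_R emb TYPE('n) \<rho>" "\<And>x. \<exists>c\<in>C. rk emb (x - c) \<le> \<rho>"
    using K_R_attained[OF assms(2)] by blast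
  have "CARD('k) ^ \<rho> \<le> CARD('l)"
    unfolding assms(3,4) using assms(3,7,8) by (intro power_increasing) auto
  then interpret cov: rank_covering emb C \<rho>
    using assms(2,5-7) C(2) by unfold_locales auto
  \<comment> \<open>The statement adds a product with the brackets reversed where
    \<open>cov.\<epsilon>\<close> subtracts \<open>up_count\<close>.\<close>
  have \<epsilon>: "cov.\<epsilon> = \<epsilon>"
    by (simp add: cov.\<epsilon>_def cov.up_count_def cov.down_count_def assms(3-5,9) algebra_simps)
  have \<delta>: "cov.\<Delta> + 2 * \<epsilon> = \<delta>"
    by (simp add: cov.\<Delta>_def assms(3,10) cov.ball_volume_eq_card)
  have "real CARD('l) ^ CARD('n) = real q ^ (m * n)"
    by (simp add: assms(4,5) power_mult)
  with cov.card_lower_bound show ?thesis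
    using assms(11) by (simp only: \<epsilon> \<delta> C(1))
qed

end
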